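(* Let $u=(1,2,\ldots,n)$. Let $m$ be a positive integer with $n-m\ge4$, and let $\{x_{j_2},\ldots,x_{j_m}\}$ be any subset of $m-1$ distinct variables in $\{x_{m+1},\ldots,x_n\}$. Then: (1) if $3\le m\le\lceil n/2\rceil$, the inequality $$x_m+\sum_{i=2}^m x_{j_i}\ \ge\ \tfrac12m(m+1)$$ is facet-defining for $H_n(u)$; (2) if $2\le m\le\lceil n/2\rceil$, the inequality $$x_m+2\sum_{i=2}^m x_{j_i}\ \ge\ m^2+1$$ is facet-defining for $H_n(u)$.
   Context: A point $x=(x_1,\ldots,x_n)\in\{1,\ldots,n\}^n$ is a circuit if the map $i\mapsto x_i$ is a permutation of $\{1,\ldots,n\}$ consisting of a single $n$-cycle. For $u=(1,\ldots,n)$, the hamiltonian circuit polytope $H_n(u)\subset\mathbb{R}^n$ is the convex hull of all circuits. An inequality is facet-defining for $H_n(u)$ if it is satisfied by all points of $H_n(u)$ and the set of points of $H_n(u)$ satisfying it at equality is a face of dimension $\dim H_n(u)-1$. *)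

theory Defs
  imports "HOL-Analysis.Analysis" "HOL-Combinatorics.Combinatorics"
begin

(* The ambient space is real^'n with n = CARD('n). The map idx : {1..n} -> 'n is a bijective
   numbering of the coordinates, so the coordinate x_i of the point x is x $ idx i. *)

definition circuit :: "(nat \<Rightarrow> 'n) \<Rightarrow> real ^ 'n::finite \<Rightarrow> bool" where
  "circuit idx x \<longleftrightarrow>
     (\<exists>p. p permutes {1..CARD('n)} \<and> cyclic_on p {1..CARD('n)} \<and>
          (\<forall>i\<in>{1..CARD('n)}. x $ idx i = real (p i)))"

definition hamiltonian_circuit_polytope :: "(nat \<Rightarrow> 'n) \<Rightarrow> (real ^ 'n::finite) set" where
  "hamiltonian_circuit_polytope idx = convex hull {x. circuit idx x}"

(* The inequality f x >= b is facet-defining for P. Besides the dimension condition,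
   facet_of requires the face to be nonempty. *)
definition facet_defining_ge :: "'a::euclidean_space set \<Rightarrow> ('a \<Rightarrow> real) \<Rightarrow> real \<Rightarrow> bool" where
  "facet_defining_ge P f b \<longleftrightarrow> (\<forall>x\<in>P. f x \<ge> b) \<and> {x \<in> P. f x = b} facet_of P"

end

theory Submission
  imports Defs
begin

text \<open>
Write \<open>V = {1..n}\<close> and \<open>J = {j\<^sub>2, \<dots>, j\<^sub>m}\<close>, so that \<open>J\<close> has \<open>m - 1\<close> elements, all larger than
\<open>m\<close>. A circuit is the point \<open>(p 1, \<dots>, p n)\<close> of a cyclic permutation \<open>p\<close> of \<open>V\<close>, called a tour
below.

Validity is counting: the values of \<open>p\<close> are distinct positive integers, so \<open>k\<close> of them sum to at
least \<open>1 + \<dots> + k\<close>. For the weighted inequality this alone would give the bound \<open>m\<^sup>2\<close>, attained only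
with \<open>p m = m\<close>; a tour has no fixed point, which gains the extra \<open>1\<close> (\<open>weighted_sum_ge\<close>).

The dimension is found by duality. The polytope lies in a hyperplane of constant coordinate sum and
the tight points form a proper face \<open>F\<close>, so \<open>dim F\<close> is at most \<open>n - 2\<close>. It is enough to show that
every linear form \<open>c\<close> which is constant on the tight circuits is a combination of the coordinate
sum and the left-hand side of the inequality (\<open>facet_defining_convex_hull\<close>); this forces equality
everywhere, and the dimension of the polytope need not be known in advance.

So let \<open>c\<close> be constant on tight circuits. Tightness depends only on \<open>p m\<close> and on the values of \<open>p\<close>
on \<open>J\<close>. Cut a tight tour into four arcs that end outside \<open>{m} \<union> J\<close>. Rearranging the arcs in the six
possible cyclic orders keeps the tour tight and changes \<open>p\<close> only at the four ends, and the six
resulting linear equations say that \<open>c\<close> takes the same value at these ends (\<open>block_exchange\<close>). Since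
\<open>n - m \<ge> 4\<close>, any two indices outside \<open>{m} \<union> J\<close> can be made ends of four such arcs, hence \<open>c\<close> is a
constant \<open>\<gamma>\<close> there. From then on, the value of a tour under \<open>c\<close> only depends on \<open>p m\<close> and on \<open>p\<close>
restricted to \<open>J\<close>, and comparing a few explicit tours determines the rest: exchanging two values
on \<open>J\<close> shows that \<open>c\<close> is a constant \<open>\<delta>\<close> on \<open>J\<close> (\<open>weights_constant\<close>). In case (1), tours with
\<open>p m = 1\<close> and \<open>p m = 2\<close> give \<open>c m = \<delta>\<close>. In case (2), tours with \<open>p m = m - 1\<close> and
\<open>p m = m + 1\<close> give \<open>\<delta> - \<gamma> = 2 (c m - \<gamma>)\<close>. The tours needed are all produced by one statement,
\<open>tour_exists\<close>: a disjoint system of prescribed paths can be closed up to a tour.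
\<close>

section \<open>Tours as cyclic lists\<close>

definition tour :: "'a set \<Rightarrow> ('a \<Rightarrow> 'a) \<Rightarrow> bool" where
  "tour V p \<longleftrightarrow> p permutes V \<and> cyclic_on p V"

definition follows :: "('a \<Rightarrow> 'a) \<Rightarrow> 'a list \<Rightarrow> bool" where
  "follows p = successively (\<lambda>x y. p x = y)"

lemma follows_append:
  assumes "A \<noteq> []" "B \<noteq> []"
  shows "follows p (A @ B) \<longleftrightarrow> follows p A \<and> follows p B \<and> p (last A) = hd B"
  using assms by (auto simp: follows_def successively_append_iff)

lemma follows_concatD:
  assumes "follows p (concat Ws)" "A \<in> set Ws"
  shows "follows p A"
  using assms by (induction Ws) (auto simp: follows_def successively_append_iff)

lemma follows_agree:
  assumes "follows p A" "follows q A" "x \<in> set A" "x \<noteq> last A"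
  shows "p x = q x"
  using assms
  by (induction A rule: induct_list012) (auto simp: follows_def split: if_splits)

lemma tour_of_list:
  assumes "distinct w" "w \<noteq> []"
  obtains p where "tour (set w) p" "follows p w" "p (last w) = hd w"
proof -
  define p where "p = cycle_of_list w"
  let ?n = "length w"
  have step: "(p ^^ k) (w ! i) = w ! ((i + k) mod ?n)" if "i < ?n" for i k
  proof -
    have "(p ^^ k) (w ! i) = rotate k w ! i"
      using cyclic_rotation[OF assms(1), of k] that unfolding p_def by (metis nth_map)
    then show ?thesis
      using that by (simp add: nth_rotate add.commute)
  qed
  have "orbit p (w ! 0) = set w"
  proof
    show "orbit p (w ! 0) \<subseteq> set w"
      using step[of 0] assms(2) by (auto simp: orbit_altdef)
    show "set w \<subseteq> orbit p (w ! 0)"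
    proof
      fix x assume "x \<in> set w"
      then obtain i where "i < ?n" "x = w ! i" by (auto simp: in_set_conv_nth)
      then have "x = (p ^^ (i + ?n)) (w ! 0)" "0 < i + ?n"
        using step[of 0 "i + ?n"] by (auto simp: assms(2))
      then show "x \<in> orbit p (w ! 0)" by (auto simp: orbit_altdef)
    qed
  qed
  then have "tour (set w) p"
    unfolding tour_def cyclic_on_def p_def using cycle_permutes assms(2) by fastforce
  moreover have "follows p w"
    unfolding follows_def successively_conv_nth
    using step[of _ 1] by auto
  moreover have "p (last w) = hd w"
    using step[of "?n - 1" 1] assms(2) by (simp add: last_conv_nth hd_conv_nth)
  ultimately show ?thesis by (rule that)
qed

lemma tour_through_four_blocks:
  assumes "distinct (A @ B @ C @ D)" "A \<noteq> []" "B \<noteq> []" "C \<noteq> []" "D \<noteq> []"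
    and "V = set A \<union> set B \<union> set C \<union> set D"
  obtains p where "tour V p" "follows p A" "follows p B" "follows p C" "follows p D"
    "p (last A) = hd B" "p (last B) = hd C" "p (last C) = hd D" "p (last D) = hd A"
proof -
  obtain p where "tour (set (A @ B @ C @ D)) p" "follows p (A @ B @ C @ D)"
      "p (last (A @ B @ C @ D)) = hd (A @ B @ C @ D)"
    using tour_of_list[of "A @ B @ C @ D"] assms by auto
  then show ?thesis
    using that[of p] assms by (auto simp: follows_append Un_assoc)
qed

text \<open>Traversing the blocks \<open>A, B, C, D\<close> in each of the six cyclic orders gives tours that differ only at
the last elements of the blocks. Writing \<open>c\<^sub>X\<close> for \<open>c\<close> at the end of \<open>X\<close> and \<open>h\<^sub>X\<close> for \<open>h\<close> at its head,
subtracting the two orders in which \<open>C\<close> is followed by \<open>A\<close>, and likewise by \<open>B\<close> and by \<open>D\<close>,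
leaves three homogeneous equations in \<open>c\<^sub>A, c\<^sub>B, c\<^sub>D\<close>; a signed sum of them is
\<open>2 (c\<^sub>A - c\<^sub>B) (h\<^sub>C - h\<^sub>D) = 0\<close>. Three blocks would not do: they admit only two cyclic orders.\<close>

lemma block_exchange:
  fixes c h :: "'a \<Rightarrow> real"
  assumes dist: "distinct (A @ B @ C @ D)"
    and ne: "A \<noteq> []" "B \<noteq> []" "C \<noteq> []" "D \<noteq> []"
    and V: "V = set A \<union> set B \<union> set C \<union> set D"
    and h: "inj_on h V"
    and const: "\<And>p. tour V p \<Longrightarrow> follows p A \<Longrightarrow> follows p B \<Longrightarrow> follows p C \<Longrightarrow> follows p D
      \<Longrightarrow> (\<Sum>v\<in>V. c v * h (p v)) = K"
  shows "c (last A) = c (last B)"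
proof -
  let ?a = "last A" and ?b = "last B" and ?e = "last C" and ?d = "last D"
  let ?E = "{?a, ?b, ?e, ?d}"
  have fin: "finite V" and E: "?E \<subseteq> V"
    using V ne by auto
  obtain p0 where p0: "tour V p0" "follows p0 A" "follows p0 B" "follows p0 C" "follows p0 D"
    using tour_through_four_blocks[OF dist ne V] by metis
  define R where "R = (\<Sum>v\<in>V - ?E. c v * h (p0 v))"
  \<comment> \<open>Only the four ends change, so every order of the blocks has the same remainder \<open>R\<close>.\<close>
  have order: "c ?a * h (hd X) + c (last X) * h (hd Y) + c (last Y) * h (hd Z) + c (last Z) * h (hd A)
      = K - R"
    if XYZ: "{X, Y, Z} = {B, C, D}" "distinct (A @ X @ Y @ Z)" for X Y Z
  proof -
    have "\<forall>W\<in>{X, Y, Z}. W \<noteq> []"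
      unfolding XYZ(1) using ne by simp
    then have ne': "X \<noteq> []" "Y \<noteq> []" "Z \<noteq> []"
      by simp_all
    have "\<Union> (set ` {X, Y, Z}) = \<Union> (set ` {B, C, D})"
      by (simp only: XYZ(1))
    then have V': "V = set A \<union> set X \<union> set Y \<union> set Z"
      by (simp add: V Un_assoc)
    have "last ` {X, Y, Z} = last ` {B, C, D}"
      by (simp only: XYZ(1))
    then have E': "?E = {?a, last X, last Y, last Z}"
      by simp
    obtain p where p: "tour V p" "follows p A" "follows p X" "follows p Y" "follows p Z"
        "p ?a = hd X" "p (last X) = hd Y" "p (last Y) = hd Z" "p (last Z) = hd A"
      using tour_through_four_blocks[OF XYZ(2) ne(1) ne' V'] by metis
    have "\<forall>W\<in>{X, Y, Z}. follows p W"
      using p by simp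
    then have pB: "follows p B" "follows p C" "follows p D"
      unfolding XYZ(1) by simp_all
    have "p v = p0 v" if "v \<in> V - ?E" for v
    proof -
      have "v \<in> set A \<or> v \<in> set B \<or> v \<in> set C \<or> v \<in> set D"
        using that V by auto
      then show ?thesis
        using that pB p(2) p0 follows_agree[of p _ p0 v] by (elim disjE) simp_all
    qed
    then have "(\<Sum>v\<in>V - ?E. c v * h (p v)) = R"
      unfolding R_def by (intro sum.cong) auto
    then have "K = R + (\<Sum>v\<in>?E. c v * h (p v))"
      using const[OF p(1,2) pB] sum.subset_diff[OF E fin, of "\<lambda>v. c v * h (p v)"] by simp
    moreover have "?a \<notin> {last X, last Y, last Z}" "last X \<notin> {last Y, last Z}" "last Y \<noteq> last Z"
      using XYZ(2) last_in_set[OF ne(1)] last_in_set[OF ne'(1)] last_in_set[OF ne'(2)]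
        last_in_set[OF ne'(3)] by auto
    ultimately show ?thesis unfolding E' using p by simp
  qed
  have "c ?a * h (hd B) + c ?b * h (hd C) + c ?e * h (hd D) + c ?d * h (hd A) = K - R"
    by (rule order, blast) (use dist in auto)
  moreover have "c ?a * h (hd B) + c ?b * h (hd D) + c ?d * h (hd C) + c ?e * h (hd A) = K - R"
    by (rule order, blast) (use dist in auto)
  moreover have "c ?a * h (hd C) + c ?e * h (hd B) + c ?b * h (hd D) + c ?d * h (hd A) = K - R"
    by (rule order, blast) (use dist in auto)
  moreover have "c ?a * h (hd C) + c ?e * h (hd D) + c ?d * h (hd B) + c ?b * h (hd A) = K - R"
    by (rule order, blast) (use dist in auto)
  moreover have "c ?a * h (hd D) + c ?d * h (hd B) + c ?b * h (hd C) + c ?e * h (hd A) = K - R"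
    by (rule order, blast) (use dist in auto)
  moreover have "c ?a * h (hd D) + c ?d * h (hd C) + c ?e * h (hd B) + c ?b * h (hd A) = K - R"
    by (rule order, blast) (use dist in auto)
  ultimately have "c ?a * (h (hd D) - h (hd C)) = c ?b * (h (hd D) - h (hd C))"
    by (simp add: algebra_simps)
  moreover have "hd C \<in> V" "hd D \<in> V" "hd C \<noteq> hd D"
    using dist ne V by (auto simp: disjoint_iff) (metis hd_in_set)
  then have "h (hd D) \<noteq> h (hd C)"
    using h by (metis inj_onD)
  ultimately show ?thesis by simp
qed

section \<open>Tours with prescribed steps\<close>

text \<open>The path \<open>L\<close> together with the disjoint single steps from \<open>d\<close> to \<open>g d\<close> prescribes a partial
successor map on \<open>V\<close>. The conditions ensure that it decomposes \<open>V\<close> into paths, so that it has no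
cycle and any arrangement of the paths is a tour.\<close>

locale prescribed_steps =
  fixes V :: "'a set" and L :: "'a list" and D :: "'a set" and g :: "'a \<Rightarrow> 'a"
  assumes finite_V: "finite V"
    and L: "distinct L" "L \<noteq> []" "set L \<subseteq> V"
    and D: "D \<subseteq> V" "g ` D \<subseteq> V" "inj_on g D" "D \<inter> g ` D = {}"
    and L_D: "set L \<inter> D = {}" "set L \<inter> g ` D = {}"
begin

text \<open>The path of the system that ends in \<open>x\<close>. The elements of \<open>V\<close> without a prescribed successor are
exactly the ends of the paths, so they serve to index the paths.\<close>

definition chain :: "'a \<Rightarrow> 'a list" where
  "chain x = (if x = last L then L else if x \<in> g ` D then [inv_into D g x, x] else [x])"

definition ends :: "'a set" where
  "ends = V - D - set (butlast L)"

lemma chain_nonempty: "chain x \<noteq> []"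
  using L by (simp add: chain_def)

lemma last_chain: "last (chain x) = x"
  by (simp add: chain_def)

lemma last_L_in_ends: "last L \<in> ends"
proof -
  have "L = butlast L @ [last L]" using L by simp
  then have "last L \<notin> set (butlast L)"
    using L(1) by (metis distinct_append disjoint_iff list.set_intros(1))
  moreover have "last L \<notin> D"
    using L_D(1) last_in_set[OF L(2)] by blast
  ultimately show ?thesis
    using L by (auto simp: ends_def)
qed

lemma g_in_ends: "d \<in> D \<Longrightarrow> g d \<in> ends"
  using D L_D by (auto simp: ends_def dest: in_set_butlastD)

lemma set_chain:
  assumes "x \<in> ends"
  shows "set (chain x) = (if x = last L then set L else insert x {d \<in> D. g d = x})"
proof -
  have "{d \<in> D. g d = x} = {inv_into D g x}" if "x \<in> g ` D"
    using D(3) that by (auto simp: inj_on_def f_inv_into_f inv_into_into)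
  then show ?thesis
    by (auto simp: chain_def)
qed

lemma chain_distinct: "distinct (chain x)"
proof -
  have "inv_into D g x \<noteq> x" if "x \<in> g ` D"
    using inv_into_into[OF that] that D(4) by (metis disjoint_iff)
  then show ?thesis
    using L(1) by (simp add: chain_def)
qed

lemma chain_disjoint:
  assumes "x \<in> ends" "y \<in> ends" "x \<noteq> y"
  shows "set (chain x) \<inter> set (chain y) = {}"
proof -
  have "set L = insert (last L) (set (butlast L))"
    using L(2) by (metis append_butlast_last_id list.simps(15) rotate1.simps(2) set_rotate1)
  then show ?thesis
    using assms L_D by (auto simp: set_chain ends_def)
qed

lemma chain_cover: "(\<Union>x\<in>ends. set (chain x)) = V"
proof
  show "(\<Union>x\<in>ends. set (chain x)) \<subseteq> V"
    using L D by (auto simp: set_chain ends_def split: if_splits)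
  have "v \<in> (\<Union>x\<in>ends. set (chain x))" if v: "v \<in> V" for v
  proof -
    consider "v \<in> ends" | "v \<in> D" | "v \<in> set (butlast L)"
      using v unfolding ends_def by blast
    then show ?thesis
    proof cases
      case 1
      then show ?thesis using last_chain[of v] chain_nonempty[of v] last_in_set by force
    next
      case 2
      then show ?thesis using g_in_ends[of v] L_D last_in_set[OF L(2)] by (force simp: set_chain)
    next
      case 3
      then show ?thesis using last_L_in_ends by (auto simp: set_chain dest: in_set_butlastD)
    qed
  qed
  then show "V \<subseteq> (\<Union>x\<in>ends. set (chain x))" by blast
qed

lemma distinct_concat_chains:
  "distinct xs \<Longrightarrow> set xs \<subseteq> ends \<Longrightarrow> distinct (concat (map chain xs))"
proof (induction xs)
  case (Cons x xs)
  have "set (chain x) \<inter> set (chain y) = {}" if "y \<in> set xs" for y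
    using that Cons.prems by (intro chain_disjoint) auto
  then have "set (chain x) \<inter> set (concat (map chain xs)) = {}"
    by (simp add: Int_UN_distrib)
  then show ?case
    using Cons by (simp add: chain_distinct)
qed simp

lemma follows_chains:
  assumes "\<And>x. x \<in> ends \<Longrightarrow> follows p (chain x)"
  shows "follows p L" "d \<in> D \<Longrightarrow> p d = g d"
proof -
  show "follows p L"
    using assms[OF last_L_in_ends] by (simp add: chain_def)
  assume d: "d \<in> D"
  then have "g d \<noteq> last L" using L_D(2) last_in_set[OF L(2)] by (metis IntI empty_iff imageI)
  then have "chain (g d) = [d, g d]"
    using d D(3) by (simp add: chain_def)
  then show "p d = g d"
    using assms[OF g_in_ends[OF d]] by (simp add: follows_def)
qed

lemma finite_ends: "finite ends"
  using finite_V by (simp add: ends_def)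

theorem tour_exists:
  obtains p where "tour V p" "follows p L" "\<And>d. d \<in> D \<Longrightarrow> p d = g d"
proof -
  obtain xs where xs: "set xs = ends" "distinct xs"
    using finite_distinct_list[OF finite_ends] by blast
  let ?w = "concat (map chain xs)"
  have w: "distinct ?w" "set ?w = V"
    using distinct_concat_chains xs chain_cover by auto
  moreover have "?w \<noteq> []"
    using w(2) L by force
  ultimately obtain p where p: "tour V p" "follows p ?w"
    using tour_of_list by metis
  have chains: "follows p (chain x)" if "x \<in> ends" for x
    by (rule follows_concatD[OF p(2)]) (use that xs(1) in simp)
  show ?thesis
    by (rule that[OF p(1) follows_chains[OF chains]])
qed

text \<open>Given two ends, two of the four blocks are their paths, the third is the path of another end, and
the fourth is the concatenation of all remaining paths. It is here that at least four ends are
required.\<close>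

theorem constant_on_ends:
  fixes c h :: "'a \<Rightarrow> real"
  assumes four: "4 \<le> card ends"
    and h: "inj_on h V"
    and const: "\<And>p. tour V p \<Longrightarrow> follows p L \<Longrightarrow> (\<And>d. d \<in> D \<Longrightarrow> p d = g d)
      \<Longrightarrow> (\<Sum>v\<in>V. c v * h (p v)) = K"
    and ab: "a \<in> ends" "b \<in> ends"
  shows "c a = c b"
proof (cases "a = b")
  case False
  have "card {a, b} = 2"
    using False by simp
  then have "2 \<le> card (ends - {a, b})"
    using four ab card_Diff_subset[of "{a, b}" ends] by simp
  then obtain e where e: "e \<in> ends - {a, b}"
    by (metis card.empty ex_in_conv not_numeral_le_zero)
  obtain xs where xs: "set xs = ends - {a, b} - {e}" "distinct xs"
    using finite_distinct_list[of "ends - {a, b} - {e}"] finite_ends by blast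
  have "card (ends - {a, b} - {e}) \<noteq> 0"
    using card_Diff_singleton[OF e] \<open>2 \<le> card (ends - {a, b})\<close> by linarith
  then have "xs \<noteq> []"
    using xs(1) by (metis card.empty list.set(1))
  let ?D = "concat (map chain xs)"
  have ends: "ends = set ([a, b, e] @ xs)"
    using ab e by (auto simp: xs(1))
  have "distinct ([a, b, e] @ xs)"
    using xs(2) False e by (auto simp: xs(1))
  then have "distinct (concat (map chain ([a, b, e] @ xs)))"
    by (rule distinct_concat_chains) (simp only: ends subset_refl)
  then have dist: "distinct (chain a @ chain b @ chain e @ ?D)"
    by simp
  have "c (last (chain a)) = c (last (chain b))"
  proof (rule block_exchange[OF dist _ _ _ _ _ h])
    show "chain a \<noteq> []" "chain b \<noteq> []" "chain e \<noteq> []" by (fact chain_nonempty)+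
    show "?D \<noteq> []"
      using \<open>xs \<noteq> []\<close> chain_nonempty by (cases xs) auto
    have "(\<Union>x\<in>ends. set (chain x)) = set (chain a) \<union> set (chain b) \<union> set (chain e) \<union> set ?D"
      unfolding ends by auto
    then show "V = set (chain a) \<union> set (chain b) \<union> set (chain e) \<union> set ?D"
      by (simp only: chain_cover)
  next
    fix p
    assume p: "tour V p" "follows p (chain a)" "follows p (chain b)" "follows p (chain e)" "follows p ?D"
    have chains: "follows p (chain x)" if "x \<in> ends" for x
    proof -
      have "x = a \<or> x = b \<or> x = e \<or> chain x \<in> set (map chain xs)"
        using that unfolding ends by auto
      then show ?thesis
        using p follows_concatD[OF p(5)] by blast
    qed
    show "(\<Sum>v\<in>V. c v * h (p v)) = K"
      by (rule const[OF p(1) follows_chains[OF chains]])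
  qed
  then show ?thesis by (simp add: last_chain)
qed simp

end

section \<open>Tight tours and the forms constant on them\<close>

lemma double_gauss: "2 * \<Sum>{1..k} = k * (k + 1)" for k :: nat
  by (induction k) auto

text \<open>The \<open>i\<close>-th smallest of distinct positive integers is at least \<open>i\<close>. The inequality is doubled to
avoid division on the natural numbers.\<close>

lemma double_sum_positive_ge:
  fixes A :: "nat set"
  assumes "finite A" "0 \<notin> A"
  shows "card A * (card A + 1) \<le> 2 * \<Sum>A"
  using assms
proof (induction A rule: finite_linorder_max_induct)
  case (insert b A)
  then have "A \<subseteq> {1..<b}"
    by (auto simp: Suc_le_eq intro: gr0I)
  then have "card A \<le> b - 1"
    using card_mono[of "{1..<b}" A] by simp
  then have "card A + 1 \<le> b"
    using insert.prems by (cases b) auto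
  moreover have "b \<notin> A" using insert.hyps by auto
  ultimately show ?case
    using insert by auto
qed simp

lemma tour_no_fixpoint:
  assumes "tour V p" "x \<in> V" "V \<noteq> {x}"
  shows "p x \<noteq> x"
proof
  assume "p x = x"
  have "orbit p x = V"
    using assms(1,2) by (simp add: tour_def orbit_cyclic_eq3)
  moreover have "y = x" if "y \<in> orbit p x" for y
    using that by (induction) (simp_all add: \<open>p x = x\<close>)
  ultimately have "V \<subseteq> {x}" by blast
  then show False using assms(2,3) by blast
qed

locale index_set =
  fixes n m :: nat and J :: "nat set"
  assumes m: "2 \<le> m" "m + 4 \<le> n"
    and J: "J \<subseteq> {m+1..n}" "card J = m - 1"
begin

abbreviation "V \<equiv> {1..n}"

lemma finite_J: "finite J"
  using J(1) finite_subset by blast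

lemma J_bounds: "v \<in> J \<Longrightarrow> m < v \<and> v \<le> n"
  using J(1) by auto

lemma m_notin_J: "m \<notin> J"
  using J(1) by auto

lemma J_nonempty: "J \<noteq> {}"
  using J(2) m by auto

lemma J_sum_ge:
  assumes "tour V p"
  shows "m * (m - 1) \<le> 2 * sum p J" "m * (m + 1) \<le> 2 * (p m + sum p J)"
proof -
  have inj: "inj p"
    using assms permutes_inj by (auto simp: tour_def)
  have pos: "p v \<noteq> 0" if "v \<in> insert m J" for v
    using permutes_in_image[of p V v] assms that J(1) m by (fastforce simp: tour_def)
  have "inj_on p A" for A
    using inj inj_on_subset by blast
  then have "card (p ` A) = card A" "\<Sum>(p ` A) = sum p A" for A
    by (simp_all add: card_image sum.reindex)
  then have "card A * (card A + 1) \<le> 2 * sum p A" if "A \<subseteq> insert m J" for A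
    using double_sum_positive_ge[of "p ` A"] that pos finite_J finite_subset[OF that]
    by fastforce
  from this[of J] this[of "insert m J"]
  show "m * (m - 1) \<le> 2 * sum p J" "m * (m + 1) \<le> 2 * (p m + sum p J)"
    using m J(2) finite_J m_notin_J by (auto simp: mult.commute)
qed

text \<open>The left-hand side is \<open>2 (p m + sum p J) - p m\<close>. If \<open>p m < m\<close>, bound the first term by the sum of the
\<open>m\<close> smallest values; if \<open>p m > m\<close>, bound \<open>sum p J\<close> by the sum of the \<open>m - 1\<close> smallest values.
Equality holds only for \<open>p m = m - 1\<close> and for \<open>p m = m + 1\<close>.\<close>

lemma weighted_sum_ge:
  assumes "tour V p"
  shows "m * m + 1 \<le> p m + 2 * sum p J"
proof -
  have "n \<in> V" "n \<noteq> m" "m \<in> V" using m by auto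
  then have "p m \<noteq> m"
    using tour_no_fixpoint[OF assms, of m] by blast
  then consider "p m \<le> m - 1" | "m + 1 \<le> p m" by linarith
  then show ?thesis
  proof cases
    case 1
    then have "m * m + m + p m \<le> 2 * (p m + sum p J) + (m - 1)"
      using J_sum_ge(2)[OF assms] by simp
    then show ?thesis using m by simp
  next
    case 2
    then have "m + 1 + m * (m - 1) \<le> p m + 2 * sum p J"
      using J_sum_ge(1)[OF assms] by linarith
    then show ?thesis using m by (simp add: diff_mult_distrib2)
  qed
qed

text \<open>Once \<open>c\<close> is constant outside \<open>insert m J\<close>, the value of a tour under \<open>c\<close> no longer depends on what
the tour does there, because \<open>sum p V\<close> is fixed.\<close>

lemma weighted_value:
  fixes c :: "nat \<Rightarrow> real"
  assumes p: "p permutes V" and c: "\<And>v. v \<in> V - insert m J \<Longrightarrow> c v = \<gamma>"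
  shows "(\<Sum>v\<in>V. c v * real (p v))
    = \<gamma> * real (\<Sum>V) + (c m - \<gamma>) * real (p m) + (\<Sum>v\<in>J. (c v - \<gamma>) * real (p v))"
proof -
  have "(\<Sum>v\<in>V. c v * real (p v)) = (\<Sum>v\<in>V. \<gamma> * real (p v) + (c v - \<gamma>) * real (p v))"
    by (simp add: algebra_simps)
  also have "\<dots> = \<gamma> * (\<Sum>v\<in>V. real (p v)) + (\<Sum>v\<in>V. (c v - \<gamma>) * real (p v))"
    by (simp add: sum.distrib sum_distrib_left)
  also have "(\<Sum>v\<in>V. real (p v)) = real (\<Sum>V)"
    using sum.permute[OF p, of real] by (simp add: o_def)
  also have "(\<Sum>v\<in>V. (c v - \<gamma>) * real (p v)) = (\<Sum>v\<in>insert m J. (c v - \<gamma>) * real (p v))"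
    using J(1) m c by (intro sum.mono_neutral_right) auto
  also have "\<dots> = (c m - \<gamma>) * real (p m) + (\<Sum>v\<in>J. (c v - \<gamma>) * real (p v))"
    using finite_J m_notin_J by simp
  finally show ?thesis by simp
qed

lemma weighted_value_constant:
  fixes c :: "nat \<Rightarrow> real"
  assumes p: "p permutes V" and c: "\<And>v. v \<in> V - insert m J \<Longrightarrow> c v = \<gamma>" "\<And>v. v \<in> J \<Longrightarrow> c v = \<delta>"
  shows "(\<Sum>v\<in>V. c v * real (p v))
    = \<gamma> * real (\<Sum>V) + (c m - \<gamma>) * real (p m) + (\<delta> - \<gamma>) * real (sum p J)"
proof -
  have "(\<Sum>v\<in>J. (c v - \<gamma>) * real (p v)) = (\<delta> - \<gamma>) * real (sum p J)"
    using c(2) by (simp add: sum_distrib_left)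
  then show ?thesis
    using weighted_value[of p c \<gamma>] p c(1) by metis
qed

text \<open>The following steps prescribe tours that map \<open>insert m J\<close> onto \<open>{1..m}\<close> with \<open>p m = s < m\<close>. The value
\<open>m\<close> has to be taken at some \<open>e\<close> in \<open>J\<close>, which produces the path \<open>[e, m, s]\<close>; the other elements of
\<open>J\<close>, all larger than \<open>m\<close>, are mapped by a freely chosen bijection \<open>g\<close> into numbers below \<open>m\<close>, so
these steps cannot close up to a cycle.\<close>

lemma low_steps:
  assumes "e \<in> J" "s \<in> {1..m-1}" "bij_betw g (J - {e}) ({1..m-1} - {s})"
  shows "prescribed_steps V [e, m, s] (J - {e}) g"
proof -
  have "g ` (J - {e}) = {1..m-1} - {s}" "inj_on g (J - {e})"
    using assms(3) by (auto simp: bij_betw_def)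
  then show ?thesis
    using assms(1,2) m by unfold_locales (auto dest: J_bounds)
qed

lemma low_tour_sum:
  assumes "e \<in> J" "s \<in> {1..m-1}" "bij_betw g (J - {e}) ({1..m-1} - {s})"
    and "p e = m" "\<And>d. d \<in> J - {e} \<Longrightarrow> p d = g d"
  shows "2 * (sum p J + s) = m * (m + 1)"
proof -
  have "sum p J = m + sum p (J - {e})"
    using assms(1,4) finite_J by (simp add: sum.remove)
  also have "sum p (J - {e}) = sum g (J - {e})"
    using assms(5) by (intro sum.cong) auto
  also have "\<dots> = \<Sum>({1..m-1} - {s})"
    using sum.reindex_bij_betw[OF assms(3), of id] by simp
  finally have "sum p J + s = m + \<Sum>{1..m-1}"
    using assms(2) sum.remove[of "{1..m-1}" s "\<lambda>x. x"] by simp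
  then have "2 * (sum p J + s) = 2 * m + (m - 1) * (m - 1 + 1)"
    using double_gauss[of "m - 1"] by simp
  then show ?thesis using m by (simp add: algebra_simps diff_mult_distrib2)
qed

lemma low_bijection:
  assumes "e \<in> J" "s \<in> {1..m-1}"
  obtains g where "bij_betw g (J - {e}) ({1..m-1} - {s})"
proof -
  have "card (J - {e}) = card ({1..m-1} - {s})"
    using assms J(2) finite_J by simp
  then show ?thesis
    using that finite_J finite_same_card_bij[of "J - {e}" "{1..m-1} - {s}"] by blast
qed

lemma low_tour_exists:
  assumes "e \<in> J" "s \<in> {1..m-1}" "bij_betw g (J - {e}) ({1..m-1} - {s})"
  obtains p where "tour V p" "p m = s" "p e = m" "\<And>d. d \<in> J - {e} \<Longrightarrow> p d = g d"
    "2 * (sum p J + s) = m * (m + 1)"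
proof -
  obtain p where p: "tour V p" "follows p [e, m, s]" "\<And>d. d \<in> J - {e} \<Longrightarrow> p d = g d"
    using prescribed_steps.tour_exists[OF low_steps[OF assms]] by blast
  then have "p m = s" "p e = m"
    by (simp_all add: follows_def)
  then show ?thesis
    using that p low_tour_sum[OF assms] by blast
qed

text \<open>Outside \<open>insert m J\<close> this is the exchange of paths. On \<open>J\<close>, two tours cannot differ by a
transposition of values alone, but now the values outside \<open>insert m J\<close> are irrelevant, so it is
enough to compare tours whose restrictions to \<open>J\<close> differ by a transposition.\<close>

lemma weights_constant:
  fixes c :: "nat \<Rightarrow> real"
  assumes s: "s \<in> {1..m-1}"
    and const: "\<And>p. tour V p \<Longrightarrow> p m = s \<Longrightarrow> 2 * (sum p J + s) = m * (m + 1)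
      \<Longrightarrow> (\<Sum>v\<in>V. c v * real (p v)) = K"
  obtains \<gamma> \<delta> where "\<And>v. v \<in> V - insert m J \<Longrightarrow> c v = \<gamma>" "\<And>v. v \<in> J \<Longrightarrow> c v = \<delta>"
proof -
  obtain e0 where e0: "e0 \<in> J" using J_nonempty by blast
  obtain g0 where g0: "bij_betw g0 (J - {e0}) ({1..m-1} - {s})"
    using low_bijection[OF e0 s] by blast
  interpret prescribed_steps V "[e0, m, s]" "J - {e0}" g0
    by (rule low_steps[OF e0 s g0])
  have ends: "ends = V - insert m J"
    unfolding ends_def using e0 by auto
  have "card (V - insert m J) = n - m"
    using J m finite_J m_notin_J by (subst card_Diff_subset) auto
  then have four: "4 \<le> card ends"
    unfolding ends using m by simp
  have "c a = c b" if "a \<in> ends" "b \<in> ends" for a b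
  proof (rule constant_on_ends[OF four _ _ that])
    show "inj_on real V" by simp
    fix p assume p: "tour V p" "follows p [e0, m, s]" "\<And>d. d \<in> J - {e0} \<Longrightarrow> p d = g0 d"
    then have "p m = s" "p e0 = m" by (simp_all add: follows_def)
    then show "(\<Sum>v\<in>V. c v * real (p v)) = K"
      using const p(1) low_tour_sum[OF e0 s g0 _ p(3)] by blast
  qed
  then obtain \<gamma> where \<gamma>: "\<And>v. v \<in> V - insert m J \<Longrightarrow> c v = \<gamma>"
    unfolding ends by metis
  have "c e = c e'" if e: "e \<in> J" "e' \<in> J" "e \<noteq> e'" for e e'
  proof -
    obtain g where g: "bij_betw g (J - {e}) ({1..m-1} - {s})"
      using low_bijection[OF e(1) s] by blast
    \<comment> \<open>The bijection that lets \<open>e\<close> and \<open>e'\<close> trade their values: now \<open>e'\<close> is mapped to \<open>m\<close>.\<close>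
    define g' where "g' = g \<circ> Transposition.transpose e e'"
    have "Transposition.transpose e e' ` (J - {e'}) = J - {e}"
      using e by (auto simp: image_iff Transposition.transpose_def)
    then have "bij_betw (Transposition.transpose e e') (J - {e'}) (J - {e})"
      by (auto simp: bij_betw_def intro: inj_on_subset[OF inj_transpose])
    then have g': "bij_betw g' (J - {e'}) ({1..m-1} - {s})"
      unfolding g'_def using g bij_betw_trans by blast
    obtain p where p: "tour V p" "p m = s" "p e = m" "\<And>d. d \<in> J - {e} \<Longrightarrow> p d = g d"
        "2 * (sum p J + s) = m * (m + 1)"
      using low_tour_exists[OF e(1) s g] by blast
    obtain q where q: "tour V q" "q m = s" "q e' = m" "\<And>d. d \<in> J - {e'} \<Longrightarrow> q d = g' d"
        "2 * (sum q J + s) = m * (m + 1)"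
      using low_tour_exists[OF e(2) s g'] by blast
    have "(\<Sum>v\<in>V. c v * real (p v)) = (\<Sum>v\<in>V. c v * real (q v))"
      using const[OF p(1,2,5)] const[OF q(1,2,5)] by simp
    then have eq: "(\<Sum>v\<in>J. (c v - \<gamma>) * real (p v)) = (\<Sum>v\<in>J. (c v - \<gamma>) * real (q v))"
      using weighted_value[of p c \<gamma>] weighted_value[of q c \<gamma>] p q \<gamma> by (simp add: tour_def)
    have split: "sum f J = sum f (J - {e, e'}) + (f e + f e')" for f :: "nat \<Rightarrow> real"
      using sum.subset_diff[of "{e, e'}" J f] e finite_J by simp
    have "(\<Sum>v\<in>J - {e, e'}. (c v - \<gamma>) * real (p v)) = (\<Sum>v\<in>J - {e, e'}. (c v - \<gamma>) * real (q v))"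
      using p(4) q(4) by (intro sum.cong) (auto simp: g'_def Transposition.transpose_def)
    then have "(c e - \<gamma>) * real (p e) + (c e' - \<gamma>) * real (p e')
        = (c e - \<gamma>) * real (q e) + (c e' - \<gamma>) * real (q e')"
      using eq unfolding split by linarith
    moreover have "p e' = g e'" "q e = g e'"
      using p(4) q(4) e by (auto simp: g'_def)
    ultimately have "(c e - c e') * (real m - real (g e')) = 0"
      using p(3) q(3) by (simp add: algebra_simps)
    moreover have "g e' \<in> {1..m-1}"
      using g e by (auto simp: bij_betw_def)
    ultimately show ?thesis using m by auto
  qed
  then obtain \<delta> where "\<And>v. v \<in> J \<Longrightarrow> c v = \<delta>"
    by metis
  then show ?thesis using that \<gamma> by blast
qed

text \<open>The second kind of tight tour for the weighted inequality: \<open>p m = m + 1\<close>, and \<open>J\<close> is mapped onto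
\<open>{1..m-1}\<close>. If \<open>m + 1\<close> itself belongs to \<open>J\<close>, its prescribed step continues the path that starts
at \<open>m\<close>.\<close>

lemma high_tour_exists:
  obtains p where "tour V p" "p m = m + 1" "2 * sum p J = m * (m - 1)"
proof -
  obtain g where g: "bij_betw g J {1..m-1}"
    using finite_same_card_bij[of J "{1..m-1}"] finite_J J(2) by auto
  then have im: "g ` J = {1..m-1}" and inj: "inj_on g J"
    by (auto simp: bij_betw_def)
  have "\<exists>p. tour V p \<and> p m = m + 1 \<and> (\<forall>d\<in>J. p d = g d)"
  proof (cases "m + 1 \<in> J")
    case True
    have "g ` (J - {m + 1}) = {1..m-1} - {g (m + 1)}"
      using im inj True by (auto simp: inj_on_def)
    moreover have "g (m + 1) \<in> {1..m-1}"
      using im True by blast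
    ultimately have "prescribed_steps V [m, m + 1, g (m + 1)] (J - {m + 1}) g"
      using inj m True by unfold_locales (auto intro: inj_on_subset dest: J_bounds)
    then obtain p where "tour V p" "follows p [m, m + 1, g (m + 1)]" "\<And>d. d \<in> J - {m + 1} \<Longrightarrow> p d = g d"
      using prescribed_steps.tour_exists by blast
    then show ?thesis
      by (intro exI[of _ p]) (auto simp: follows_def)
  next
    case False
    then have "prescribed_steps V [m, m + 1] J g"
      using im inj m by unfold_locales (auto dest: J_bounds)
    then obtain p where "tour V p" "follows p [m, m + 1]" "\<And>d. d \<in> J \<Longrightarrow> p d = g d"
      using prescribed_steps.tour_exists by blast
    then show ?thesis
      by (intro exI[of _ p]) (auto simp: follows_def)
  qed
  then obtain p where p: "tour V p" "p m = m + 1" "\<forall>d\<in>J. p d = g d" by blast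
  have "sum p J = \<Sum>{1..m-1}"
    using p(3) sum.reindex_bij_betw[OF g, of id] by simp
  then have "2 * sum p J = m * (m - 1)"
    using double_gauss[of "m - 1"] m by simp
  then show ?thesis using that p by blast
qed

text \<open>Such a tour is not tight for either inequality, which shows that the faces are proper.\<close>

lemma slack_tour_exists:
  obtains p where "tour V p" "p m = n"
proof -
  have "prescribed_steps V [m, n] {} id"
    using m by unfold_locales auto
  then obtain p where "tour V p" "follows p [m, n]"
    using prescribed_steps.tour_exists by blast
  then show ?thesis using that by (simp add: follows_def)
qed

text \<open>Tight tours with \<open>p m = 1\<close> and with \<open>p m = 2\<close> exist because \<open>m \<ge> 3\<close>; passing from one to the other
moves one unit between \<open>p m\<close> and \<open>sum p J\<close>, so \<open>c m\<close> equals the value of \<open>c\<close> on \<open>J\<close>.\<close>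

lemma normals_sum:
  fixes c :: "nat \<Rightarrow> real"
  assumes "3 \<le> m"
    and const: "\<And>p. tour V p \<Longrightarrow> 2 * (p m + sum p J) = m * (m + 1)
      \<Longrightarrow> (\<Sum>v\<in>V. c v * real (p v)) = K"
  obtains \<alpha> \<beta> where "\<And>v. v \<in> V \<Longrightarrow> c v = \<alpha> + \<beta> * of_bool (v \<in> insert m J)"
proof -
  have s: "1 \<in> {1..m-1}" "2 \<in> {1..m-1}" using assms(1) by auto
  obtain \<gamma> \<delta> where \<gamma>: "\<And>v. v \<in> V - insert m J \<Longrightarrow> c v = \<gamma>" and \<delta>: "\<And>v. v \<in> J \<Longrightarrow> c v = \<delta>"
    by (rule weights_constant[OF s(1), of c K]) (use const in \<open>auto simp: algebra_simps\<close>)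
  obtain e where e: "e \<in> J" using J_nonempty by blast
  have K: "\<gamma> * real (\<Sum>V) + (c m - \<gamma>) * real s + (\<delta> - \<gamma>) * (real (m * (m + 1)) / 2 - real s) = K"
    if s: "s \<in> {1..m-1}" for s
  proof -
    obtain g where g: "bij_betw g (J - {e}) ({1..m-1} - {s})"
      using low_bijection[OF e s] by blast
    obtain p where p: "tour V p" "p m = s" "2 * (sum p J + s) = m * (m + 1)"
      using low_tour_exists[OF e s g] by blast
    have "real (sum p J) = real (m * (m + 1)) / 2 - real s"
      unfolding p(3)[symmetric] by (simp add: field_simps)
    moreover have "K = (\<Sum>v\<in>V. c v * real (p v))"
      using const[OF p(1)] p(2,3) by (simp add: add.commute)
    moreover have "p permutes V"
      using p(1) by (simp add: tour_def)
    ultimately show ?thesis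
      using weighted_value_constant[of p c \<gamma> \<delta>] \<gamma> \<delta> p(2) by metis
  qed
  have "c m = \<delta>"
    using K[OF s(1)] K[OF s(2)] by (simp add: algebra_simps)
  then have "c v = \<gamma> + (\<delta> - \<gamma>) * of_bool (v \<in> insert m J)" if "v \<in> V" for v
    using that \<gamma> \<delta> by auto
  then show ?thesis by (rule that)
qed

text \<open>Passing from \<open>p m = m - 1\<close> to \<open>p m = m + 1\<close> within the tight tours raises \<open>p m\<close> by two and lowers
\<open>sum p J\<close> by one, which fixes the ratio of the two weights.\<close>

lemma normals_weighted_sum:
  fixes c :: "nat \<Rightarrow> real"
  assumes const: "\<And>p. tour V p \<Longrightarrow> p m + 2 * sum p J = m * m + 1
      \<Longrightarrow> (\<Sum>v\<in>V. c v * real (p v)) = K"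
  obtains \<alpha> \<beta> where "\<And>v. v \<in> V \<Longrightarrow> c v = \<alpha> + \<beta> * (of_bool (v = m) + 2 * of_bool (v \<in> J))"
proof -
  have s: "m - 1 \<in> {1..m-1}" using m by auto
  have tight: "p m + 2 * sum p J = m * m + 1"
    if "p m = m - 1" "2 * (sum p J + (m - 1)) = m * (m + 1)" for p
    using that m by (simp add: algebra_simps)
  obtain \<gamma> \<delta> where \<gamma>: "\<And>v. v \<in> V - insert m J \<Longrightarrow> c v = \<gamma>" and \<delta>: "\<And>v. v \<in> J \<Longrightarrow> c v = \<delta>"
    by (rule weights_constant[OF s, of c K]) (use const tight in blast)+
  have val: "K = \<gamma> * real (\<Sum>V) + (c m - \<gamma>) * real (p m) + (\<delta> - \<gamma>) * real (sum p J)"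
    if "tour V p" "p m + 2 * sum p J = m * m + 1" for p
    using weighted_value_constant[of p c \<gamma> \<delta>] that \<gamma> \<delta> const[OF that] by (metis tour_def)
  obtain e where e: "e \<in> J" using J_nonempty by blast
  obtain g where g: "bij_betw g (J - {e}) ({1..m-1} - {m-1})"
    using low_bijection[OF e s] by blast
  obtain p where p: "tour V p" "p m = m - 1" "2 * (sum p J + (m - 1)) = m * (m + 1)"
    using low_tour_exists[OF e s g] by blast
  obtain q where q: "tour V q" "q m = m + 1" "2 * sum q J = m * (m - 1)"
    using high_tour_exists by blast
  have q': "q m + 2 * sum q J = m * m + 1"
    using q m by (simp add: diff_mult_distrib2)
  have "sum p J = sum q J + 1"
    using tight[OF p(2,3)] q' p(2) q(2) m by simp
  then have "\<delta> - \<gamma> = 2 * (c m - \<gamma>)"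
    using val[OF p(1) tight[OF p(2,3)]] val[OF q(1) q'] p(2) q(2) m
    by (simp add: of_nat_diff algebra_simps)
  then have "c v = \<gamma> + (c m - \<gamma>) * (of_bool (v = m) + 2 * of_bool (v \<in> J))" if "v \<in> V" for v
    using that \<gamma> \<delta> m_notin_J by auto
  then show ?thesis by (rule that)
qed

end

section \<open>Facets of a convex hull\<close>

text \<open>The hyperplane normal to \<open>u\<close> gives \<open>dim (convex hull X) \<le> DIM - 1\<close>, and a proper face has smaller
dimension. Conversely, a vector orthogonal to all differences of tight points is constant on them;
if all such vectors lie in a space of dimension at most two, the differences span a space of
dimension at least \<open>DIM - 2\<close>. The two bounds leave no room.\<close>

lemma facet_defining_convex_hull:
  fixes X :: "'a::euclidean_space set"
  assumes u: "u \<noteq> 0" "\<And>x. x \<in> X \<Longrightarrow> u \<bullet> x = N"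
    and valid: "\<And>x. x \<in> X \<Longrightarrow> b \<le> f \<bullet> x"
    and tight: "x0 \<in> X" "f \<bullet> x0 = b"
    and proper: "y \<in> X" "f \<bullet> y \<noteq> b"
    and normals: "\<And>c K. (\<And>x. x \<in> X \<Longrightarrow> f \<bullet> x = b \<Longrightarrow> c \<bullet> x = K) \<Longrightarrow> c \<in> span {u, f}"
  shows "facet_defining_ge (convex hull X) (\<lambda>x. f \<bullet> x) b"
proof -
  let ?P = "convex hull X" and ?T = "{x \<in> X. f \<bullet> x = b}"
  let ?F = "{x \<in> ?P. f \<bullet> x = b}" and ?D = "(\<lambda>x. x - x0) ` {x \<in> X. f \<bullet> x = b}"
  have "?P \<subseteq> {x. b \<le> f \<bullet> x}"
    using valid by (intro hull_minimal) (auto simp: convex_halfspace_ge)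
  then have ge: "b \<le> f \<bullet> x" if "x \<in> ?P" for x using that by auto
  have "?P \<inter> {x. f \<bullet> x = b} face_of ?P"
    using ge by (intro face_of_Int_supporting_hyperplane_ge) auto
  moreover have "?P \<inter> {x. f \<bullet> x = b} = ?F" by auto
  ultimately have face: "?F face_of ?P" by simp
  have TF: "?T \<subseteq> ?F" by (auto intro: hull_inc)
  have "?P \<subseteq> {x. u \<bullet> x = N}"
    using u by (intro hull_minimal) (auto simp: convex_hyperplane)
  then have P_le: "aff_dim ?P \<le> int DIM('a) - 1"
    using aff_dim_subset[of ?P "{x. u \<bullet> x = N}"] u(1) by (simp add: aff_dim_hyperplane)
  have "y \<in> ?P" "y \<notin> ?F" using proper by (auto intro: hull_inc)
  then have "?F \<noteq> ?P" by blast
  then have lt: "aff_dim ?F < aff_dim ?P"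
    using face by (intro face_of_aff_dim_lt) auto
  have "{c. \<forall>x\<in>span ?D. orthogonal x c} \<subseteq> span {u, f}"
  proof
    fix c assume "c \<in> {c. \<forall>x\<in>span ?D. orthogonal x c}"
    then have *: "orthogonal (x - x0) c" if "x \<in> X" "f \<bullet> x = b" for x
      using that by (auto intro: span_base)
    show "c \<in> span {u, f}"
    proof (rule normals)
      show "c \<bullet> x = c \<bullet> x0" if "x \<in> X" "f \<bullet> x = b" for x
        using *[OF that] by (simp add: orthogonal_def inner_commute[of _ c] inner_diff_right)
    qed
  qed
  then have "dim {c. \<forall>x\<in>span ?D. orthogonal x c} \<le> card {u, f}"
    by (meson dim_le_card finite.intros)
  also have "\<dots> \<le> 2" by (simp add: card_insert_if)
  finally have "DIM('a) \<le> dim ?D + 2"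
    using dim_subspace_orthogonal_to_vectors[of "span ?D" UNIV] by (simp add: dim_span)
  moreover have "aff_dim ?T = int (dim ?D)"
    using tight by (intro aff_dim_eq_dim_subtract hull_inc) auto
  moreover have "aff_dim ?T \<le> aff_dim ?F" using TF by (rule aff_dim_subset)
  ultimately have "aff_dim ?F = aff_dim ?P - 1" using lt P_le by linarith
  moreover have "?F \<noteq> {}" using TF tight by blast
  ultimately show ?thesis
    unfolding facet_defining_ge_def facet_of_def using face ge by blast
qed

section \<open>Circuits as points\<close>

locale circuit_points = index_set n m J
  for n m :: nat and J :: "nat set" +
  fixes idx :: "nat \<Rightarrow> 'n::finite"
  assumes n: "n = CARD('n)" and idx: "bij_betw idx {1..n} (UNIV :: 'n set)"
begin

text \<open>Coefficients indexed by \<open>1, \<dots>, n\<close>, transported along the numbering \<open>idx\<close> of the coordinates.\<close>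

definition weight_vector :: "(nat \<Rightarrow> real) \<Rightarrow> real ^ 'n" where
  "weight_vector w = (\<chi> k. w (inv_into {1..n} idx k))"

lemma weight_vector_idx: "v \<in> V \<Longrightarrow> weight_vector w $ idx v = w v"
  using idx by (simp add: weight_vector_def bij_betw_def)

lemma inner_by_idx: "c \<bullet> x = (\<Sum>v\<in>V. c $ idx v * x $ idx v)" for c x :: "real ^ 'n"
  using sum.reindex_bij_betw[OF idx, of "\<lambda>k. c $ k * x $ k"] by (simp add: inner_vec_def)

lemma inner_weight_vector: "weight_vector w \<bullet> x = (\<Sum>v\<in>V. w v * x $ idx v)"
  by (simp add: inner_by_idx weight_vector_idx)

definition point :: "(nat \<Rightarrow> nat) \<Rightarrow> real ^ 'n" where
  "point p = weight_vector (\<lambda>v. real (p v))"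

lemma circuit_iff_tour: "circuit idx x \<longleftrightarrow> (\<exists>p. tour V p \<and> x = point p)"
proof -
  have "(\<forall>v\<in>V. x $ idx v = real (p v)) \<longleftrightarrow> x = point p" for p
  proof
    assume *: "\<forall>v\<in>V. x $ idx v = real (p v)"
    have "x $ k = point p $ k" for k
    proof -
      obtain v where "v \<in> V" "k = idx v"
        using idx by (metis UNIV_I bij_betw_def imageE)
      then show ?thesis using * by (simp add: point_def weight_vector_idx)
    qed
    then show "x = point p" by (simp add: vec_eq_iff)
  qed (simp add: point_def weight_vector_idx)
  then show ?thesis
    unfolding circuit_def n[symmetric] tour_def by blast
qed

lemma inner_point: "c \<bullet> point p = (\<Sum>v\<in>V. c $ idx v * real (p v))" for c :: "real ^ 'n"
  by (simp add: inner_by_idx point_def weight_vector_idx)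

lemma sum_with_coefficients:
  fixes y :: "nat \<Rightarrow> real"
  shows "(\<Sum>v\<in>V. (of_bool (v = m) + k * of_bool (v \<in> J)) * y v) = y m + k * sum y J"
proof -
  have "(\<Sum>v\<in>V. (of_bool (v = m) + k * of_bool (v \<in> J)) * y v)
      = (\<Sum>v\<in>V. if v = m then y v else 0) + k * (\<Sum>v\<in>V. if v \<in> J then y v else 0)"
    unfolding sum_distrib_left sum.distrib[symmetric]
    by (intro sum.cong) (auto simp: algebra_simps)
  also have "(\<Sum>v\<in>V. if v = m then y v else 0) = y m"
    using m by simp
  also have "(\<Sum>v\<in>V. if v \<in> J then y v else 0) = sum y (V \<inter> J)"
    by (simp add: sum.inter_restrict)
  also have "V \<inter> J = J"
    using J(1) by auto
  finally show ?thesis .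
qed

text \<open>The geometric criterion, restated for tours: \<open>u\<close> is the coordinate sum and \<open>f\<close> the left-hand side of
the inequality. Both cases of the theorem have this form, with \<open>k = 1\<close> and with \<open>k = 2\<close>.\<close>

lemma facet_defining:
  fixes k b :: real
  assumes valid: "\<And>p. tour V p \<Longrightarrow> b \<le> real (p m) + k * real (sum p J)"
    and tight: "tour V p0" "real (p0 m) + k * real (sum p0 J) = b"
    and slack: "tour V q" "real (q m) + k * real (sum q J) \<noteq> b"
    and normals: "\<And>c K. (\<And>p. tour V p \<Longrightarrow> real (p m) + k * real (sum p J) = b
        \<Longrightarrow> (\<Sum>v\<in>V. c v * real (p v)) = K)
      \<Longrightarrow> \<exists>\<alpha> \<beta>. \<forall>v\<in>V. c v = \<alpha> + \<beta> * (of_bool (v = m) + k * of_bool (v \<in> J))"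
  shows "facet_defining_ge (hamiltonian_circuit_polytope idx)
    (\<lambda>x. x $ idx m + k * (\<Sum>v\<in>J. x $ idx v)) b"
proof -
  define u :: "real ^ 'n" where "u = weight_vector (\<lambda>_. 1)"
  define f :: "real ^ 'n" where "f = weight_vector (\<lambda>v. of_bool (v = m) + k * of_bool (v \<in> J))"
  have f: "f \<bullet> x = x $ idx m + k * (\<Sum>v\<in>J. x $ idx v)" for x
    unfolding f_def inner_weight_vector by (rule sum_with_coefficients)
  have fp: "f \<bullet> point p = real (p m) + k * real (sum p J)" for p
  proof -
    have "(\<Sum>v\<in>J. point p $ idx v) = (\<Sum>v\<in>J. real (p v))"
      using J(1) by (intro sum.cong) (auto simp: point_def intro!: weight_vector_idx)
    moreover have "point p $ idx m = real (p m)"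
      using m by (simp add: point_def weight_vector_idx)
    ultimately show ?thesis by (simp add: f)
  qed
  have "facet_defining_ge (convex hull {x. circuit idx x}) (\<lambda>x. f \<bullet> x) b"
  proof (rule facet_defining_convex_hull[where u = u and N = "real (\<Sum>V)"])
    have "1 \<in> V" using m by simp
    then have "u $ idx 1 = 1"
      unfolding u_def by (rule weight_vector_idx)
    then show "u \<noteq> 0" by auto
    show "u \<bullet> x = real (\<Sum>V)" if x: "x \<in> {x. circuit idx x}" for x
    proof -
      obtain p where p: "tour V p" "x = point p"
        using x by (auto simp: circuit_iff_tour)
      have "u \<bullet> x = (\<Sum>v\<in>V. real (p v))"
        by (simp add: p(2) inner_point u_def weight_vector_idx)
      also have "\<dots> = real (\<Sum>V)"
        using p(1) sum.permute[of p V real] by (simp add: tour_def o_def)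
      finally show ?thesis .
    qed
    show "b \<le> f \<bullet> x" if "x \<in> {x. circuit idx x}" for x
      using that valid by (auto simp: circuit_iff_tour fp)
    show "point p0 \<in> {x. circuit idx x}" "point q \<in> {x. circuit idx x}"
      using tight slack by (auto simp: circuit_iff_tour)
    show "f \<bullet> point p0 = b" "f \<bullet> point q \<noteq> b"
      using tight slack by (simp_all add: fp)
    fix c :: "real ^ 'n" and K
    assume c: "\<And>x. x \<in> {x. circuit idx x} \<Longrightarrow> f \<bullet> x = b \<Longrightarrow> c \<bullet> x = K"
    have "(\<Sum>v\<in>V. c $ idx v * real (p v)) = K"
      if "tour V p" "real (p m) + k * real (sum p J) = b" for p
    proof -
      have "point p \<in> {x. circuit idx x}" "f \<bullet> point p = b"
        using that by (auto simp: circuit_iff_tour fp)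
      then have "c \<bullet> point p = K"
        by (rule c)
      then show ?thesis
        by (simp only: inner_point)
    qed
    then obtain \<alpha> \<beta> where ab: "\<forall>v\<in>V. c $ idx v = \<alpha> + \<beta> * (of_bool (v = m) + k * of_bool (v \<in> J))"
      using normals[of "\<lambda>v. c $ idx v"] by blast
    have "c = \<alpha> *\<^sub>R u + \<beta> *\<^sub>R f"
    proof (unfold vec_eq_iff, rule allI)
      fix i
      obtain v where "v \<in> V" "i = idx v"
        using idx by (metis UNIV_I bij_betw_def imageE)
      then show "c $ i = (\<alpha> *\<^sub>R u + \<beta> *\<^sub>R f) $ i"
        using ab by (simp add: u_def f_def weight_vector_idx)
    qed
    then show "c \<in> span {u, f}"
      by (simp add: span_add span_scale span_base)
  qed
  then show ?thesis
    by (simp add: f hamiltonian_circuit_polytope_def)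
qed

lemma tight_iff_sum:
  "real a + 1 * real t = real m * (real m + 1) / 2 \<longleftrightarrow> 2 * (a + t) = m * (m + 1)"
proof -
  have "real a + 1 * real t = real m * (real m + 1) / 2
      \<longleftrightarrow> real (2 * (a + t)) = real (m * (m + 1))"
    by (auto simp: field_simps)
  then show ?thesis unfolding of_nat_eq_iff .
qed

lemma tight_iff_weighted_sum:
  "real a + 2 * real t = (real m)\<^sup>2 + 1 \<longleftrightarrow> a + 2 * t = m * m + 1"
proof -
  have "real a + 2 * real t = (real m)\<^sup>2 + 1 \<longleftrightarrow> real (a + 2 * t) = real (m * m + 1)"
    by (simp add: power2_eq_square add.commute)
  then show ?thesis unfolding of_nat_eq_iff .
qed

theorem sum_facet_defining:
  assumes "3 \<le> m"
  shows "facet_defining_ge (hamiltonian_circuit_polytope idx)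
    (\<lambda>x. x $ idx m + (\<Sum>v\<in>J. x $ idx v)) (real m * (real m + 1) / 2)"
proof -
  obtain e where e: "e \<in> J" using J_nonempty by blast
  have s: "1 \<in> {1..m-1}" using m by simp
  obtain p0 where p0: "tour V p0" "p0 m = 1" "2 * (sum p0 J + 1) = m * (m + 1)"
    using low_bijection[OF e s] low_tour_exists[OF e s] by metis
  obtain q where q: "tour V q" "q m = n"
    using slack_tour_exists by blast
  have "facet_defining_ge (hamiltonian_circuit_polytope idx)
    (\<lambda>x. x $ idx m + 1 * (\<Sum>v\<in>J. x $ idx v)) (real m * (real m + 1) / 2)"
  proof (rule facet_defining)
    fix p assume "tour V p"
    then have "real (m * (m + 1)) \<le> real (2 * (p m + sum p J))"
      using J_sum_ge(2) of_nat_mono by blast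
    then show "real m * (real m + 1) / 2 \<le> real (p m) + 1 * real (sum p J)"
      by (simp add: field_simps)
  next
    show "tour V p0" "tour V q" by fact+
    show "real (p0 m) + 1 * real (sum p0 J) = real m * (real m + 1) / 2"
      unfolding tight_iff_sum using p0 by simp
    \<comment> \<open>Here \<open>q m = n\<close> is at least \<open>m + 4\<close>.\<close>
    have "m * (m - 1) + 2 * (m + 4) \<le> 2 * (q m + sum q J)"
      using J_sum_ge(1)[OF q(1)] q(2) m by simp
    moreover have "m * (m - 1) + 2 * (m + 4) > m * (m + 1)"
      using m by (simp add: diff_mult_distrib2)
    ultimately show "real (q m) + 1 * real (sum q J) \<noteq> real m * (real m + 1) / 2"
      unfolding tight_iff_sum by linarith
  next
    fix c :: "nat \<Rightarrow> real" and K
    assume c: "\<And>p. tour V p \<Longrightarrow> real (p m) + 1 * real (sum p J) = real m * (real m + 1) / 2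
      \<Longrightarrow> (\<Sum>v\<in>V. c v * real (p v)) = K"
    obtain \<alpha> \<beta> where ab: "\<And>v. v \<in> V \<Longrightarrow> c v = \<alpha> + \<beta> * of_bool (v \<in> insert m J)"
      by (rule normals_sum[OF assms, of c K]) (use c in \<open>unfold tight_iff_sum, blast\<close>)+
    then show "\<exists>\<alpha> \<beta>. \<forall>v\<in>V. c v = \<alpha> + \<beta> * (of_bool (v = m) + 1 * of_bool (v \<in> J))"
      using m_notin_J by (intro exI[of _ \<alpha>] exI[of _ \<beta>]) auto
  qed
  then show ?thesis by simp
qed

theorem weighted_sum_facet_defining:
  "facet_defining_ge (hamiltonian_circuit_polytope idx)
    (\<lambda>x. x $ idx m + 2 * (\<Sum>v\<in>J. x $ idx v)) ((real m)\<^sup>2 + 1)"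
proof -
  obtain p0 where p0: "tour V p0" "p0 m = m + 1" "2 * sum p0 J = m * (m - 1)"
    using high_tour_exists by blast
  obtain q where q: "tour V q" "q m = n"
    using slack_tour_exists by blast
  show ?thesis
  proof (rule facet_defining)
    fix p assume "tour V p"
    then have "real (m * m + 1) \<le> real (p m + 2 * sum p J)"
      using weighted_sum_ge of_nat_mono by blast
    then show "(real m)\<^sup>2 + 1 \<le> real (p m) + 2 * real (sum p J)"
      by (simp add: power2_eq_square)
  next
    show "tour V p0" "tour V q" by fact+
    show "real (p0 m) + 2 * real (sum p0 J) = (real m)\<^sup>2 + 1"
      unfolding tight_iff_weighted_sum using p0 m by (simp add: diff_mult_distrib2)
    have "m * (m - 1) + (m + 4) \<le> q m + 2 * sum q J"
      using J_sum_ge(1)[OF q(1)] q(2) m by simp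
    moreover have "m * (m - 1) + (m + 4) > m * m + 1"
      using m by (simp add: diff_mult_distrib2)
    ultimately show "real (q m) + 2 * real (sum q J) \<noteq> (real m)\<^sup>2 + 1"
      unfolding tight_iff_weighted_sum by linarith
  next
    fix c :: "nat \<Rightarrow> real" and K
    assume c: "\<And>p. tour V p \<Longrightarrow> real (p m) + 2 * real (sum p J) = (real m)\<^sup>2 + 1
      \<Longrightarrow> (\<Sum>v\<in>V. c v * real (p v)) = K"
    obtain \<alpha> \<beta> where "\<And>v. v \<in> V \<Longrightarrow> c v = \<alpha> + \<beta> * (of_bool (v = m) + 2 * of_bool (v \<in> J))"
      by (rule normals_weighted_sum[of c K]) (use c in \<open>unfold tight_iff_weighted_sum, blast\<close>)+
    then show "\<exists>\<alpha> \<beta>. \<forall>v\<in>V. c v = \<alpha> + \<beta> * (of_bool (v = m) + 2 * of_bool (v \<in> J))"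
      by blast
  qed
qed

end

theorem theorem14:
  fixes n m :: nat and idx :: "nat \<Rightarrow> 'n::finite" and j :: "nat \<Rightarrow> nat"
  assumes "n = CARD('n)"
    and "bij_betw idx {1..n} (UNIV :: 'n set)"
    and "m \<ge> 1"
    and "int n - int m \<ge> 4"
    and "inj_on j {2..m}"
    and "j ` {2..m} \<subseteq> {m+1..n}"
  shows "(3 \<le> m \<and> int m \<le> \<lceil>real n / 2\<rceil> \<longrightarrow>
            facet_defining_ge (hamiltonian_circuit_polytope idx)
              (\<lambda>x. x $ idx m + (\<Sum>i=2..m. x $ idx (j i)))
              (real m * (real m + 1) / 2)) \<and>
         (2 \<le> m \<and> int m \<le> \<lceil>real n / 2\<rceil> \<longrightarrow>
            facet_defining_ge (hamiltonian_circuit_polytope idx)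
              (\<lambda>x. x $ idx m + 2 * (\<Sum>i=2..m. x $ idx (j i)))
              ((real m)\<^sup>2 + 1))"
proof -
  have points: "circuit_points n m (j ` {2..m}) idx" if "2 \<le> m"
    using assms that by unfold_locales (auto simp: card_image)
  have sums: "(\<Sum>v\<in>j ` {2..m}. x $ idx v) = (\<Sum>i=2..m. x $ idx (j i))" for x :: "real ^ 'n"
    using sum.reindex[OF assms(5)] by (simp add: o_def)
  show ?thesis
    using circuit_points.sum_facet_defining[OF points, unfolded sums]
      circuit_points.weighted_sum_facet_defining[OF points, unfolded sums] by auto
qed

end
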